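(* Let $\sigma=\{\sigma_i \mid i\in I\}$ be a partition of the set of all primes and let $G$ be a finite group that is $\sigma$-full. Then the set $\mathcal{L}_{\sigma per}(G)$ of all $\sigma$-permutable subgroups of $G$ is a sublattice of the lattice $\mathcal{L}(G)$ of all subgroups of $G$; that is, for all $A,B\in\mathcal{L}_{\sigma per}(G)$ both $\langle A,B\rangle$ and $A\cap B$ belong to $\mathcal{L}_{\sigma per}(G)$.
   Context: All groups are finite. $\sigma=\{\sigma_i\mid i\in I\}$ is a partition of the set $\mathbb{P}$ of all primes into pairwise disjoint sets. $\pi(G)$ denotes the set of primes dividing $|G|$. A set $\mathcal{H}$ of subgroups of $G$ is a complete Hall $\sigma$-set of $G$ if every member $\neq 1$ of $\mathcal{H}$ is a Hall $\sigma_i$-subgroup of $G$ for some $i$, and $\mathcal{H}$ contains exactly one Hall $\sigma_i$-subgroup of $G$ for every $i$ with $\sigma_i\cap\pi(G)\neq\emptyset$. $G$ is $\sigma$-full if it possesses a complete Hall $\sigma$-set. A subgroup $A$ of $G$ is $\sigma$-permutable in $G$ if $G$ is $\sigma$-full and $AH=HA$ for every Hall $\sigma_i$-subgroup $H$ of $G$ and every $i\in I$. *)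

theory Defs
  imports
    "HOL-Algebra.Generated_Groups"
    "HOL-Algebra.Complete_Lattice"
    "HOL-Computational_Algebra.Primes"
    "HOL-Library.Disjoint_Sets"
begin

definition group_primes :: "('a, 'b) monoid_scheme \<Rightarrow> nat set" where
  "group_primes G = prime_factors (order G)"

definition hall_subgroup :: "nat set \<Rightarrow> 'a set \<Rightarrow> ('a, 'b) monoid_scheme \<Rightarrow> bool" where
  "hall_subgroup \<pi> H G \<longleftrightarrow>
     subgroup H G \<and>
     prime_factors (card H) \<subseteq> \<pi> \<and>
     prime_factors (card (rcosets\<^bsub>G\<^esub> H)) \<inter> \<pi> = {}"

text \<open>
  A partition of the primes is given as its set \<open>\<sigma>\<close> of blocks, so a quantifier over the
  indices of the partition becomes a quantifier over the blocks \<open>s \<in> \<sigma>\<close>.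
\<close>

definition complete_hall_set ::
    "nat set set \<Rightarrow> 'a set set \<Rightarrow> ('a, 'b) monoid_scheme \<Rightarrow> bool" where
  "complete_hall_set \<sigma> \<H> G \<longleftrightarrow>
     (\<forall>H\<in>\<H>. subgroup H G) \<and>
     (\<forall>H\<in>\<H>. H \<noteq> {\<one>\<^bsub>G\<^esub>} \<longrightarrow> (\<exists>s\<in>\<sigma>. hall_subgroup s H G)) \<and>
     (\<forall>s\<in>\<sigma>. s \<inter> group_primes G \<noteq> {} \<longrightarrow> (\<exists>!H. H \<in> \<H> \<and> hall_subgroup s H G))"

definition sigma_full :: "nat set set \<Rightarrow> ('a, 'b) monoid_scheme \<Rightarrow> bool" where
  "sigma_full \<sigma> G \<longleftrightarrow> (\<exists>\<H>. complete_hall_set \<sigma> \<H> G)"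

definition sigma_permutable ::
    "nat set set \<Rightarrow> 'a set \<Rightarrow> ('a, 'b) monoid_scheme \<Rightarrow> bool" where
  "sigma_permutable \<sigma> A G \<longleftrightarrow>
     subgroup A G \<and> sigma_full \<sigma> G \<and>
     (\<forall>s\<in>\<sigma>. \<forall>H. hall_subgroup s H G \<longrightarrow> A <#>\<^bsub>G\<^esub> H = H <#>\<^bsub>G\<^esub> A)"

definition sigma_permutable_subgroups ::
    "nat set set \<Rightarrow> ('a, 'b) monoid_scheme \<Rightarrow> 'a set set" where
  "sigma_permutable_subgroups \<sigma> G = {A. sigma_permutable \<sigma> A G}"

text \<open>This is the order shown to be a complete lattice in \<open>group.subgroups_complete_lattice\<close>.\<close>

definition subgroup_lattice :: "('a, 'b) monoid_scheme \<Rightarrow> 'a set gorder" where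
  "subgroup_lattice G = \<lparr>carrier = {H. subgroup H G}, eq = (=), le = (\<subseteq>)\<rparr>"

definition sublattice :: "'a set \<Rightarrow> ('a, 'b) gorder_scheme \<Rightarrow> bool" where
  "sublattice S L \<longleftrightarrow>
     S \<noteq> {} \<and> S \<subseteq> carrier L \<and>
     (\<forall>x\<in>S. \<forall>y\<in>S. x \<squnion>\<^bsub>L\<^esub> y \<in> S \<and> x \<sqinter>\<^bsub>L\<^esub> y \<in> S)"

end

theory Submission
  imports Defs "HOL-Algebra.Sylow" "HOL-Algebra.Group_Action"
begin

text \<open>
  Joins are formal: if \<open>A\<close> and \<open>B\<close> permute with \<open>H\<close>, an element of \<open>H\<close> can be moved past any word
  in \<open>A\<close> and \<open>B\<close> one letter at a time, so \<open>\<langle>A, B\<rangle>\<close> permutes with \<open>H\<close>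
  (\<open>generate_Un_set_mult_commute\<close>). Permuting with one fixed \<open>H\<close> does not pass to intersections;
  here the Hall subgroups for the other blocks of \<open>\<sigma>\<close> are essential.

  Let \<open>H\<close> be a Hall \<open>s\<close>-subgroup for a block \<open>s\<close>, and let \<open>D = AH \<inter> BH\<close>, a subgroup that contains \<open>H\<close>
  and \<open>A \<inter> B\<close>. It suffices to show \<open>(A \<inter> B)H = D\<close>, and by counting this holds once \<open>A \<inter> B\<close>
  contains a Sylow \<open>r\<close>-subgroup \<open>Q\<close> of \<open>D\<close> for every prime divisor \<open>r \<notin> s\<close> of \<open>|D|\<close>, since \<open>H\<close> already accounts for
  the primes in \<open>s\<close> (\<open>set_mult_eq_if_card_dvd_lcm\<close>).

  Let \<open>t\<close> be the block of \<open>r\<close>. As \<open>G\<close> is \<open>\<sigma>\<close>-full it has some Hall \<open>t\<close>-subgroup, whose index is prime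
  to \<open>r\<close>, so \<open>Q\<close> lies in one of its conjugates \<open>K\<close>
  (\<open>hall_subgroup_containing_prime_power_subgroup\<close>). Hall \<open>t\<close>-subgroups need not be conjugate
  to each other, but \<open>K\<close> is again a Hall \<open>t\<close>-subgroup, so \<open>A\<close> permutes with both \<open>H\<close> and \<open>K\<close>. The index
  of \<open>A\<close> in \<open>AH \<inter> AK\<close> divides the coprime numbers \<open>|H|\<close> and \<open>|K|\<close>, hence \<open>AH \<inter> AK = A\<close>
  (\<open>set_mult_Int_set_mult_coprime\<close>). Now \<open>Q\<close> lies in \<open>D \<subseteq> AH\<close> and in \<open>K \<subseteq> AK\<close>, so \<open>Q \<subseteq> A\<close>; likewise
  \<open>Q \<subseteq> B\<close>.
\<close>

section \<open>Products of subgroups\<close>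

lemma mem_set_mult_iff: "x \<in> A <#>\<^bsub>G\<^esub> B \<longleftrightarrow> (\<exists>a\<in>A. \<exists>b\<in>B. x = a \<otimes>\<^bsub>G\<^esub> b)"
  by (auto simp: set_mult_def)

lemma (in group) subset_set_mult_left:
  assumes "subgroup A G" "subgroup H G"
  shows "A \<subseteq> A <#> H"
proof
  fix a assume "a \<in> A"
  then have "a = a \<otimes> \<one>" using assms(1) by (simp add: subgroup.mem_carrier)
  then show "a \<in> A <#> H"
    using \<open>a \<in> A\<close> subgroup.one_closed[OF assms(2)] unfolding mem_set_mult_iff by blast
qed

lemma (in group) subset_set_mult_right:
  assumes "subgroup A G" "subgroup H G"
  shows "H \<subseteq> A <#> H"
proof
  fix h assume "h \<in> H"
  then have "h = \<one> \<otimes> h" using assms(2) by (simp add: subgroup.mem_carrier)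
  then show "h \<in> A <#> H"
    using \<open>h \<in> H\<close> subgroup.one_closed[OF assms(1)] unfolding mem_set_mult_iff by blast
qed

lemma (in group) set_mult_subgroup_if_commute:
  assumes A: "subgroup A G" and H: "subgroup H G" and AH: "A <#> H = H <#> A"
  shows "subgroup (A <#> H) G"
proof (rule subgroupI)
  show "A <#> H \<subseteq> carrier G"
    using subgroup.subset[OF A] subgroup.subset[OF H] by (rule setmult_subset_G)
  show "A <#> H \<noteq> {}"
    using subset_set_mult_left[OF A H] subgroup.one_closed[OF A] by blast
next
  fix x assume "x \<in> A <#> H"
  then obtain a h where x: "a \<in> A" "h \<in> H" "x = a \<otimes> h" by (auto simp: mem_set_mult_iff)
  then have "inv x = inv h \<otimes> inv a"
    using A H by (simp add: inv_mult_group subgroup.mem_carrier)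
  then have "inv x \<in> H <#> A"
    using x A H unfolding mem_set_mult_iff by (meson subgroup.m_inv_closed)
  then show "inv x \<in> A <#> H" using AH by simp
next
  fix x y assume "x \<in> A <#> H" "y \<in> A <#> H"
  then obtain a h b k where xy: "a \<in> A" "h \<in> H" "x = a \<otimes> h" "b \<in> A" "k \<in> H" "y = b \<otimes> k"
    by (auto simp: mem_set_mult_iff)
  then have "h \<otimes> b \<in> A <#> H" using AH by (auto simp: mem_set_mult_iff)
  then obtain b' h' where b': "b' \<in> A" "h' \<in> H" "h \<otimes> b = b' \<otimes> h'"
    by (auto simp: mem_set_mult_iff)
  note car = subgroup.mem_carrier[OF A] subgroup.mem_carrier[OF H]
  have "x \<otimes> y = a \<otimes> (h \<otimes> b) \<otimes> k" using xy by (simp add: car m_assoc)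
  also have "\<dots> = (a \<otimes> b') \<otimes> (h' \<otimes> k)" using xy b' by (simp add: car m_assoc)
  finally show "x \<otimes> y \<in> A <#> H"
    using xy b' A H unfolding mem_set_mult_iff by (meson subgroup.m_closed)
qed

text \<open>
  The ways to write \<open>z \<in> AH\<close> as a product differ by an element of \<open>A \<inter> H\<close>: any two of them are
  \<open>(a, h)\<close> and \<open>(at, t\<^sup>-\<^sup>1h)\<close> with \<open>t \<in> A \<inter> H\<close>. Fixing one factorisation of each \<open>z\<close>, with left
  factor \<open>\<alpha> z\<close>, turns this into a bijection \<open>AH \<times> (A \<inter> H) \<rightarrow> A \<times> H\<close>.
\<close>

lemma (in group) card_set_mult_Int:
  assumes A: "subgroup A G" and H: "subgroup H G"
  shows "card (A <#> H) * card (A \<inter> H) = card A * card H"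
proof -
  note car [simp] = subgroup.mem_carrier[OF A] subgroup.mem_carrier[OF H]
  have inv_mult [simp]: "inv x \<otimes> (x \<otimes> y) = y" "x \<otimes> (inv x \<otimes> y) = y"
    if "x \<in> carrier G" "y \<in> carrier G" for x y
    using that by (simp_all flip: m_assoc)
  have "\<forall>z\<in>A <#> H. \<exists>a. a \<in> A \<and> inv a \<otimes> z \<in> H"
  proof
    fix z assume "z \<in> A <#> H"
    then obtain a h where "a \<in> A" "h \<in> H" "z = a \<otimes> h" by (auto simp: mem_set_mult_iff)
    then show "\<exists>a. a \<in> A \<and> inv a \<otimes> z \<in> H" by (intro exI[of _ a]) simp
  qed
  then obtain \<alpha> where \<alpha>: "\<And>z. z \<in> A <#> H \<Longrightarrow> \<alpha> z \<in> A \<and> inv (\<alpha> z) \<otimes> z \<in> H"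
    by metis
  have zc: "z \<in> carrier G" if "z \<in> A <#> H" for z
    using that by (auto simp: mem_set_mult_iff)
  let ?f = "\<lambda>(z, t). (\<alpha> z \<otimes> t, inv t \<otimes> (inv (\<alpha> z) \<otimes> z))"
  let ?g = "\<lambda>(a, h). (a \<otimes> h, inv (\<alpha> (a \<otimes> h)) \<otimes> a)"
  have "bij_betw ?f ((A <#> H) \<times> (A \<inter> H)) (A \<times> H)"
  proof (rule bij_betw_byWitness[where f' = ?g])
    show "\<forall>x\<in>(A <#> H) \<times> (A \<inter> H). ?g (?f x) = x"
    proof
      fix x assume "x \<in> (A <#> H) \<times> (A \<inter> H)"
      then obtain z t where x: "x = (z, t)" and z: "z \<in> A <#> H" and t: "t \<in> A" "t \<in> H" by blast
      have \<alpha>c: "\<alpha> z \<in> carrier G" using \<alpha>[OF z] by simp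
      have "\<alpha> z \<otimes> t \<otimes> (inv t \<otimes> (inv (\<alpha> z) \<otimes> z)) = z"
        using \<alpha>c zc[OF z] t by (simp add: m_assoc)
      then show "?g (?f x) = x" using \<alpha>c t by (simp add: x)
    qed
    show "\<forall>x\<in>A \<times> H. ?f (?g x) = x"
    proof
      fix x assume "x \<in> A \<times> H"
      then obtain a h where x: "x = (a, h)" and a: "a \<in> A" and h: "h \<in> H" by blast
      define b where "b = \<alpha> (a \<otimes> h)"
      have "a \<otimes> h \<in> A <#> H" using a h by (auto simp: mem_set_mult_iff)
      then have b: "b \<in> A" using \<alpha> unfolding b_def by blast
      then show "?f (?g x) = x"
        using a h by (simp add: x b_def[symmetric] inv_mult_group m_assoc)
    qed
    show "?f ` ((A <#> H) \<times> (A \<inter> H)) \<subseteq> A \<times> H"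
      using \<alpha> A H by (auto intro: subgroup.m_closed subgroup.m_inv_closed)
    show "?g ` (A \<times> H) \<subseteq> (A <#> H) \<times> (A \<inter> H)"
    proof (rule image_subsetI)
      fix x assume "x \<in> A \<times> H"
      then obtain a h where x: "x = (a, h)" and a: "a \<in> A" and h: "h \<in> H" by blast
      define b where "b = \<alpha> (a \<otimes> h)"
      have m: "a \<otimes> h \<in> A <#> H" using a h by (auto simp: mem_set_mult_iff)
      then have b: "b \<in> A" "inv b \<otimes> (a \<otimes> h) \<in> H" using \<alpha> unfolding b_def by blast+
      then have "inv b \<otimes> (a \<otimes> h) \<otimes> inv h \<in> H"
        using h H by (meson subgroup.m_closed subgroup.m_inv_closed)
      also have "inv b \<otimes> (a \<otimes> h) \<otimes> inv h = inv b \<otimes> a" using a b(1) h by (simp add: m_assoc)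
      finally have "inv b \<otimes> a \<in> H" .
      moreover have "inv b \<otimes> a \<in> A" using a b A by (simp add: subgroup.m_closed subgroup.m_inv_closed)
      ultimately show "?g x \<in> (A <#> H) \<times> (A \<inter> H)"
        using m by (simp add: x b_def)
    qed
  qed
  then have "card ((A <#> H) \<times> (A \<inter> H)) = card (A \<times> H)" by (rule bij_betw_same_card)
  then show ?thesis by (simp add: card_cartesian_product)
qed

lemma (in group) card_subgroup_dvd:
  assumes "subgroup A G" "subgroup T G" "A \<subseteq> T"
  shows "card A dvd card T"
proof -
  have "subgroup A (G\<lparr>carrier := T\<rparr>)" using assms by (simp add: subgroup_incl)
  from group.lagrange[OF subgroup_imp_group[OF assms(2)] this] show ?thesis
    by (simp add: order_def flip: dvd_triv_right) (metis dvd_triv_right)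
qed

text \<open>
  \<open>|AH : A| = |H : A \<inter> H|\<close> divides \<open>|H|\<close>, and in the same way \<open>|AK : A|\<close> divides \<open>|K|\<close>. The index of
  \<open>A\<close> in the subgroup \<open>AH \<inter> AK\<close> divides both, so it is 1.
\<close>

lemma (in group) set_mult_Int_set_mult_coprime:
  assumes fin: "finite (carrier G)"
    and A: "subgroup A G" and H: "subgroup H G" and K: "subgroup K G"
    and AH: "A <#> H = H <#> A" and AK: "A <#> K = K <#> A"
    and cop: "coprime (card H) (card K)"
  shows "(A <#> H) \<inter> (A <#> K) = A"
proof -
  let ?T = "(A <#> H) \<inter> (A <#> K)"
  note sAH = set_mult_subgroup_if_commute[OF A H AH] and sAK = set_mult_subgroup_if_commute[OF A K AK]
  have T: "subgroup ?T G" by (rule subgroups_Inter_pair[OF sAH sAK])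
  have AT: "A \<subseteq> ?T" using subset_set_mult_left[OF A H] subset_set_mult_left[OF A K] by blast
  have finT: "finite ?T" using finite_subset[OF subgroup.subset[OF T] fin] .
  have A0: "card A > 0"
    using finite_subset[OF subgroup.subset[OF A] fin] subgroup.one_closed[OF A] card_gt_0_iff by blast
  obtain t where t: "card ?T = card A * t" using card_subgroup_dvd[OF A T AT] by (rule dvdE)
  have "t dvd card L" if L: "subgroup L G" and AL: "A <#> L = L <#> A" and TL: "?T \<subseteq> A <#> L" for L
  proof -
    have "card ?T dvd card (A <#> L)"
      by (rule card_subgroup_dvd[OF T set_mult_subgroup_if_commute[OF A L AL] TL])
    then have "card A * t dvd card A * card L"
      using card_set_mult_Int[OF A L] t by (metis dvd_mult2)
    then show ?thesis using A0 by simp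
  qed
  from this[OF H AH] this[OF K AK] have "t = 1" using cop by (auto dest: coprime_common_divisor_nat)
  then show ?thesis using card_subset_eq[OF finT AT] t by simp
qed

text \<open>
  The usual argument for subgroups of coprime index, in a form that is checked one prime at a time
  and is symmetric in \<open>X\<close> and \<open>H\<close>: by the product formula, \<open>|XH| = |X||H| / |X \<inter> H|\<close> is a multiple of
  \<open>|X||H| / gcd(|X|, |H|) = lcm(|X|, |H|)\<close>, so it is at least \<open>|D|\<close>. The symmetry yields \<open>XH = D = HX\<close>.
\<close>

lemma (in group) set_mult_eq_if_card_dvd_lcm:
  assumes fin: "finite (carrier G)"
    and X: "subgroup X G" and H: "subgroup H G" and D: "subgroup D G"
    and XD: "X \<subseteq> D" and HD: "H \<subseteq> D" and dvd: "card D dvd lcm (card X) (card H)"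
  shows "X <#> H = D"
proof (rule card_seteq)
  show finD: "finite D" using finite_subset[OF subgroup.subset[OF D] fin] .
  show sub: "X <#> H \<subseteq> D"
    using XD HD subgroup.m_closed[OF D] unfolding set_mult_def by blast
  have XH: "subgroup (X \<inter> H) G" by (rule subgroups_Inter_pair[OF X H])
  have pos: "card S > 0" if "subgroup S G" for S
    using finite_subset[OF subgroup.subset[OF that] fin] subgroup.one_closed[OF that] card_gt_0_iff by blast
  have "card (X \<inter> H) dvd gcd (card X) (card H)"
    using card_subgroup_dvd[OF XH X] card_subgroup_dvd[OF XH H] by simp
  then have "card (X <#> H) * card (X \<inter> H) dvd card (X <#> H) * gcd (card X) (card H)" by simp
  then have "lcm (card X) (card H) * gcd (card X) (card H) dvd card (X <#> H) * gcd (card X) (card H)"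
    unfolding card_set_mult_Int[OF X H] prod_gcd_lcm_nat[of "card X"] by (simp only: mult.commute)
  moreover have "gcd (card X) (card H) \<noteq> 0" using pos[OF X] by simp
  ultimately have "lcm (card X) (card H) dvd card (X <#> H)"
    using dvd_times_right_cancel_iff by blast
  with dvd have "card D dvd card (X <#> H)" by (rule dvd_trans)
  moreover have "card (X <#> H) > 0"
    using finite_subset[OF sub finD] subset_set_mult_left[OF X H] subgroup.one_closed[OF X] card_gt_0_iff
    by blast
  ultimately show "card D \<le> card (X <#> H)" by (rule dvd_imp_le)
qed

text \<open>
  Moving the elements of \<open>H\<close> to the left past generators and their inverses suffices, since a word
  can then be passed letter by letter. The induction must leave \<open>h\<close> arbitrary, because each letter
  that is passed replaces it by another element of \<open>H\<close>.
\<close>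

lemma (in group) generate_set_mult_subset:
  assumes A: "A \<subseteq> carrier G" and H: "subgroup H G"
    and step: "\<And>a h. a \<in> A \<Longrightarrow> h \<in> H \<Longrightarrow> a \<otimes> h \<in> H <#> generate G A"
    and step_inv: "\<And>a h. a \<in> A \<Longrightarrow> h \<in> H \<Longrightarrow> inv a \<otimes> h \<in> H <#> generate G A"
  shows "generate G A <#> H \<subseteq> H <#> generate G A"
proof -
  note car = generate_in_carrier[OF A] subgroup.mem_carrier[OF H]
  have "g \<otimes> h \<in> H <#> generate G A" if "g \<in> generate G A" "h \<in> H" for g h
    using that
  proof (induction g arbitrary: h rule: generate.induct)
    case one
    then have "\<one> \<otimes> h = h \<otimes> \<one>" by (simp add: car)
    then show ?case using one generate.one unfolding mem_set_mult_iff by metis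
  next
    case (eng g1 g2)
    obtain h' k2 where 2: "h' \<in> H" "k2 \<in> generate G A" "g2 \<otimes> h = h' \<otimes> k2"
      using eng.IH(2)[OF eng.prems] by (auto simp: mem_set_mult_iff)
    obtain h'' k1 where 1: "h'' \<in> H" "k1 \<in> generate G A" "g1 \<otimes> h' = h'' \<otimes> k1"
      using eng.IH(1)[OF 2(1)] by (auto simp: mem_set_mult_iff)
    have "g1 \<otimes> g2 \<otimes> h = (g1 \<otimes> h') \<otimes> k2"
      using eng.hyps eng.prems 2 by (simp add: car m_assoc)
    also have "\<dots> = h'' \<otimes> (k1 \<otimes> k2)" using 1 2 by (simp add: car m_assoc)
    finally show ?case
      using 1(1) generate.eng[OF 1(2) 2(2)] unfolding mem_set_mult_iff by blast
  qed (auto intro: step step_inv)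
  then show ?thesis by (auto simp: mem_set_mult_iff)
qed

text \<open>Inversion exchanges \<open>AH\<close> and \<open>HA\<close>.\<close>

lemma (in group) set_mult_commute_if_subset:
  assumes A: "subgroup A G" and H: "subgroup H G" and sub: "A <#> H \<subseteq> H <#> A"
  shows "A <#> H = H <#> A"
proof
  show "H <#> A \<subseteq> A <#> H"
  proof
    fix x assume "x \<in> H <#> A"
    then obtain h a where x: "h \<in> H" "a \<in> A" "x = h \<otimes> a" by (auto simp: mem_set_mult_iff)
    have "inv a \<in> A" "inv h \<in> H" using x A H by (simp_all add: subgroup.m_inv_closed)
    then have "inv a \<otimes> inv h \<in> A <#> H" unfolding mem_set_mult_iff by blast
    then have "inv a \<otimes> inv h \<in> H <#> A" using sub by blast
    then obtain k b where k: "k \<in> H" "b \<in> A" "inv a \<otimes> inv h = k \<otimes> b"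
      by (auto simp: mem_set_mult_iff)
    note car = subgroup.mem_carrier[OF A] subgroup.mem_carrier[OF H]
    have "x = inv (inv a \<otimes> inv h)" using x by (simp add: car inv_mult_group)
    also have "\<dots> = inv b \<otimes> inv k" unfolding k(3) using k(1,2) by (simp add: car inv_mult_group)
    finally have "x = inv b \<otimes> inv k" .
    moreover have "inv b \<in> A" "inv k \<in> H" using k A H by (simp_all add: subgroup.m_inv_closed)
    ultimately show "x \<in> A <#> H" unfolding mem_set_mult_iff by blast
  qed
qed (rule sub)

lemma (in group) generate_Un_set_mult_commute:
  assumes A: "subgroup A G" and B: "subgroup B G" and H: "subgroup H G"
    and AH: "A <#> H = H <#> A" and BH: "B <#> H = H <#> B"
  shows "generate G (A \<union> B) <#> H = H <#> generate G (A \<union> B)"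
proof (rule set_mult_commute_if_subset)
  have AB: "A \<union> B \<subseteq> carrier G" using A B by (simp add: subgroup.subset)
  then show "subgroup (generate G (A \<union> B)) G" by (rule generate_is_subgroup)
  show "subgroup H G" by fact
  have "a \<otimes> h \<in> H <#> generate G (A \<union> B)" if "a \<in> A \<union> B" "h \<in> H" for a h
  proof -
    have "a \<otimes> h \<in> (H <#> A) \<union> (H <#> B)"
      using that unfolding AH[symmetric] BH[symmetric] by (auto simp: mem_set_mult_iff)
    then show ?thesis by (auto simp: mem_set_mult_iff intro: generate.incl)
  qed
  moreover have "inv a \<in> A \<union> B" if "a \<in> A \<union> B" for a
    using that A B by (auto intro: subgroup.m_inv_closed)
  ultimately show "generate G (A \<union> B) <#> H \<subseteq> H <#> generate G (A \<union> B)"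
    by (intro generate_set_mult_subset AB H) auto
qed

section \<open>Subgroups of prime power order\<close>

text \<open>Without a fixed point every orbit has size a nontrivial power of \<open>p\<close>, so \<open>p\<close> divides \<open>|E|\<close>.\<close>

lemma (in group_action) prime_power_fixed_point:
  assumes p: "prime p" and ord: "order G = p ^ n" and fin: "finite E" and ndvd: "\<not> p dvd card E"
  shows "\<exists>x\<in>E. \<forall>g\<in>carrier G. \<phi> g x = x"
proof (rule ccontr)
  assume no_fix: "\<not> ?thesis"
  \<comment> \<open>The size of the orbit is written as a sum to match the double sum over orbits in \<open>disjoint_sum\<close>.\<close>
  have "p dvd (\<Sum>y\<in>R. 1)" if "R \<in> orbits G E \<phi>" for R
  proof -
    from that obtain x where x: "x \<in> E" "R = orbit G \<phi> x" unfolding orbits_def by blast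
    have "card R dvd p ^ n" using orbit_stabilizer_theorem[OF x(1)] x(2) ord by (metis dvd_triv_left)
    then obtain k where k: "card R = p ^ k" using p by (auto simp: divides_primepow_nat)
    have "k \<noteq> 0"
    proof
      assume "k = 0"
      then obtain y where "R = {y}" using k by (auto simp: card_1_singleton_iff)
      then have "R = {x}" using orbit_refl[OF x(1)] x(2) by auto
      then have "\<forall>g\<in>carrier G. \<phi> g x = x" using x(2) by (auto simp: orbit_def)
      then show False using no_fix x(1) by blast
    qed
    then show ?thesis using k by simp
  qed
  then have "p dvd (\<Sum>R\<in>orbits G E \<phi>. \<Sum>y\<in>R. 1)" by (rule dvd_sum)
  also have "\<dots> = card E" using disjoint_sum[OF fin, of "\<lambda>_. 1::nat"] by simp
  finally show False using ndvd by simp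
qed

text \<open>The inverse turns right multiplication into a left action.\<close>

lemma (in group) action_on_rcosets:
  assumes K: "subgroup K G"
  shows "group_action G (rcosets K) (\<lambda>g. \<lambda>R \<in> rcosets K. R #> inv g)"
proof -
  have sub: "R \<subseteq> carrier G" if "R \<in> rcosets K" for R
    using that rcosets_part_G[OF K] by blast
  have cl: "R #> g \<in> rcosets K" if "R \<in> rcosets K" "g \<in> carrier G" for R g
  proof -
    obtain x where "x \<in> carrier G" "R = K #> x" using \<open>R \<in> rcosets K\<close> by (auto simp: RCOSETS_def)
    then have "R #> g = K #> (x \<otimes> g)" using K that by (simp add: coset_mult_assoc subgroup.subset)
    then show ?thesis using \<open>x \<in> carrier G\<close> that by (auto simp: RCOSETS_def)
  qed
  have bij: "(\<lambda>R \<in> rcosets K. R #> inv g) \<in> Bij (rcosets K)" if g: "g \<in> carrier G" for g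
  proof -
    have "bij_betw (\<lambda>R \<in> rcosets K. R #> inv g) (rcosets K) (rcosets K)"
      by (rule bij_betw_byWitness[where f' = "\<lambda>R. R #> g"])
        (use g cl sub in \<open>auto simp: coset_mult_assoc\<close>)
    then show ?thesis by (simp add: Bij_def)
  qed
  show ?thesis
    unfolding group_action_def group_hom_def group_hom_axioms_def
  proof (intro conjI homI)
    show "group G" by (rule group_axioms)
    show "group (BijGroup (rcosets K))" by (rule group_BijGroup)
    fix g h assume gh: "g \<in> carrier G" "h \<in> carrier G"
    show "(\<lambda>R \<in> rcosets K. R #> inv g) \<in> carrier (BijGroup (rcosets K))"
      using bij[OF gh(1)] by (simp add: BijGroup_def)
    show "(\<lambda>R \<in> rcosets K. R #> inv (g \<otimes> h)) =
       (\<lambda>R \<in> rcosets K. R #> inv g) \<otimes>\<^bsub>BijGroup (rcosets K)\<^esub> (\<lambda>R \<in> rcosets K. R #> inv h)"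
      using gh bij cl sub
      by (auto simp: BijGroup_def compose_def fun_eq_iff coset_mult_assoc inv_mult_group)
  qed
qed

text \<open>
  \<open>Q\<close> acts on the cosets of \<open>K\<close> by right multiplication and fixes some \<open>Kg\<close>; the stabilizer of \<open>Kg\<close>
  is the conjugate \<open>g\<^sup>-\<^sup>1Kg\<close>.
\<close>

lemma (in group) prime_power_subgroup_in_conjugate:
  assumes fin: "finite (carrier G)" and p: "prime p"
    and Q: "subgroup Q G" and cardQ: "card Q = p ^ n"
    and K: "subgroup K G" and ndvd: "\<not> p dvd card (rcosets K)"
  obtains g where "g \<in> carrier G" "Q \<subseteq> inv g <# K #> g"
proof -
  let ?\<phi> = "\<lambda>g. \<lambda>R \<in> rcosets K. R #> inv g"
  interpret act: group_action "G\<lparr>carrier := Q\<rparr>" "rcosets K" ?\<phi>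
    using group_action.induced_action[OF action_on_rcosets[OF K] Q] .
  have "finite (rcosets K)"
    using finite_subset[OF rcosets_subset_PowG[OF K]] fin by simp
  then obtain R where R: "R \<in> rcosets K" "\<forall>q\<in>Q. R #> inv q = R"
    using act.prime_power_fixed_point[OF p, of n] ndvd cardQ by (auto simp: order_def)
  then obtain g where g: "g \<in> carrier G" "R = K #> g" by (auto simp: RCOSETS_def)
  have "Q \<subseteq> inv g <# K #> g"
  proof
    fix q assume q: "q \<in> Q"
    then have qc: "q \<in> carrier G" "inv q \<in> Q" using Q by (auto dest: subgroup.mem_carrier subgroup.m_inv_closed)
    then have "R #> q = R" using R(2) by force
    moreover have "g \<in> R" using g subgroup.one_closed[OF K] by (force simp: r_coset_def)
    ultimately have "g \<otimes> q \<in> K #> g" using g(2) unfolding r_coset_def by blast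
    then obtain k where k: "k \<in> K" "g \<otimes> q = k \<otimes> g" by (auto simp: r_coset_def)
    then have "q = inv g \<otimes> k \<otimes> g"
      using g(1) qc(1) subgroup.mem_carrier[OF K] by (metis inv_solve_left m_assoc inv_closed m_closed)
    then show "q \<in> inv g <# K #> g" using k(1) by (auto simp: r_coset_def l_coset_def)
  qed
  with g(1) show thesis by (rule that)
qed

section \<open>Hall subgroups and permutability\<close>

lemma (in group) hall_subgroup_not_dvd_index:
  assumes fin: "finite (carrier G)" and hall: "hall_subgroup s H G" and p: "prime p" "p \<in> s"
  shows "\<not> p dvd card (rcosets H)"
proof
  assume "p dvd card (rcosets H)"
  moreover have "card (rcosets H) * card H > 0"
    using lagrange[of H] hall fin order_gt_0_iff_finite by (simp add: hall_subgroup_def)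
  ultimately have "p \<in> prime_factors (card (rcosets H))" using p(1) by (simp add: prime_factors_dvd)
  then show False using hall p(2) by (auto simp: hall_subgroup_def)
qed

lemma (in group) hall_subgroup_conjugate:
  assumes fin: "finite (carrier G)" and hall: "hall_subgroup s K G" and g: "g \<in> carrier G"
  shows "hall_subgroup s (inv g <# K #> g) G"
proof -
  have K: "subgroup K G" using hall by (simp add: hall_subgroup_def)
  let ?C = "inv g <# K #> g"
  have C: "subgroup ?C G" by (rule subgroup_conjugation_is_surj1[OF g K])
  have "bij_betw (\<lambda>k. inv g \<otimes> k \<otimes> g) K ?C"
    unfolding bij_betw_def
  proof
    show "inj_on (\<lambda>k. inv g \<otimes> k \<otimes> g) K"
      using g subgroup.mem_carrier[OF K] by (auto simp: inj_on_def)
    show "(\<lambda>k. inv g \<otimes> k \<otimes> g) ` K = ?C" by (auto simp: r_coset_def l_coset_def)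
  qed
  then have card: "card ?C = card K" by (rule bij_betw_same_card[symmetric])
  have "card K > 0"
    using finite_subset[OF subgroup.subset[OF K] fin] subgroup.one_closed[OF K] card_gt_0_iff by blast
  then have "card (rcosets ?C) = card (rcosets K)"
    using lagrange[OF C] lagrange[OF K] card by (metis mult_cancel2 less_numeral_extra(3))
  then show ?thesis using hall C card by (simp add: hall_subgroup_def)
qed

text \<open>
  A complete Hall \<open>\<sigma>\<close>-set supplies a single Hall subgroup for the block of \<open>p\<close>; its conjugates
  together contain all \<open>p\<close>-subgroups.
\<close>

lemma (in group) hall_subgroup_containing_prime_power_subgroup:
  assumes fin: "finite (carrier G)" and part: "partition_on {p::nat. prime p} \<sigma>"
    and full: "sigma_full \<sigma> G" and p: "prime p" "p dvd order G"
    and Q: "subgroup Q G" "card Q = p ^ n"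
  obtains s K where "s \<in> \<sigma>" "p \<in> s" "hall_subgroup s K G" "Q \<subseteq> K"
proof -
  obtain s where s: "s \<in> \<sigma>" "p \<in> s" using part p(1) by (auto simp: partition_on_def)
  have ord: "order G > 0" using fin order_gt_0_iff_finite by blast
  then have "p \<in> s \<inter> group_primes G" using p s by (simp add: group_primes_def prime_factors_dvd)
  then have "s \<inter> group_primes G \<noteq> {}" by blast
  moreover obtain \<H> where "complete_hall_set \<sigma> \<H> G" using full by (auto simp: sigma_full_def)
  then have "\<forall>s\<in>\<sigma>. s \<inter> group_primes G \<noteq> {} \<longrightarrow> (\<exists>!H. H \<in> \<H> \<and> hall_subgroup s H G)"
    unfolding complete_hall_set_def by simp
  ultimately have "\<exists>!H. H \<in> \<H> \<and> hall_subgroup s H G" using s(1) by simp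
  then obtain K where K: "hall_subgroup s K G" by blast
  then have sK: "subgroup K G" by (simp add: hall_subgroup_def)
  have "\<not> p dvd card (rcosets K)" by (rule hall_subgroup_not_dvd_index[OF fin K p(1) s(2)])
  then obtain g where "g \<in> carrier G" "Q \<subseteq> inv g <# K #> g"
    using prime_power_subgroup_in_conjugate[OF fin p(1) Q sK] by blast
  then show thesis using that[OF s hall_subgroup_conjugate[OF fin K]] by blast
qed

lemma hall_subgroups_coprime:
  assumes "hall_subgroup s H G" "hall_subgroup s' K G" "s \<inter> s' = {}" "card H > 0" "card K > 0"
  shows "coprime (card H) (card K)"
proof (rule ccontr)
  assume "\<not> coprime (card H) (card K)"
  then have "gcd (card H) (card K) \<noteq> 1" by (simp add: coprime_iff_gcd_eq_1)
  then obtain p where "prime p" "p dvd gcd (card H) (card K)" using prime_factor_nat by blast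
  then have "p \<in> s \<inter> s'" using assms by (auto simp: hall_subgroup_def prime_factors_dvd)
  then show False using assms(3) by simp
qed

text \<open>
  Both products are shown to be \<open>D = AH \<inter> BH\<close>. For the divisibility that this requires,
  \<open>H\<close> supplies the full \<open>r\<close>-part of \<open>|D|\<close> when \<open>r \<in> s\<close>, being a Hall subgroup of \<open>G\<close>; for \<open>r \<notin> s\<close>
  it comes from \<open>A \<inter> B\<close>, which contains a Sylow \<open>r\<close>-subgroup \<open>Q\<close> of \<open>D\<close>: \<open>A\<close> and \<open>B\<close> also permute
  with a Hall subgroup \<open>K \<supseteq> Q\<close> for the block of \<open>r\<close>, and \<open>AH \<inter> AK = A\<close>, \<open>BH \<inter> BK = B\<close>.
\<close>

lemma (in group) Int_set_mult_hall_commute: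
  assumes fin: "finite (carrier G)" and part: "partition_on {p::nat. prime p} \<sigma>"
    and Aper: "sigma_permutable \<sigma> A G" and Bper: "sigma_permutable \<sigma> B G"
    and s: "s \<in> \<sigma>" and hall: "hall_subgroup s H G"
  shows "(A \<inter> B) <#> H = H <#> (A \<inter> B)"
proof -
  have full: "sigma_full \<sigma> G" using Aper by (simp add: sigma_permutable_def)
  have A: "subgroup A G" and B: "subgroup B G" using Aper Bper by (simp_all add: sigma_permutable_def)
  have H: "subgroup H G" using hall by (simp add: hall_subgroup_def)
  have perm: "C <#> K = K <#> C"
    if "sigma_permutable \<sigma> C G" "t \<in> \<sigma>" "hall_subgroup t K G" for C t K
    using that unfolding sigma_permutable_def by blast
  note AH = perm[OF Aper s hall] and BH = perm[OF Bper s hall]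
  define D where "D = (A <#> H) \<inter> (B <#> H)"
  have D: "subgroup D G"
    unfolding D_def by (intro subgroups_Inter_pair set_mult_subgroup_if_commute A B H AH BH)
  have X: "subgroup (A \<inter> B) G" by (rule subgroups_Inter_pair[OF A B])
  have XD: "A \<inter> B \<subseteq> D"
    unfolding D_def using subset_set_mult_left[OF A H] subset_set_mult_left[OF B H] by blast
  have HD: "H \<subseteq> D"
    unfolding D_def using subset_set_mult_right[OF A H] subset_set_mult_right[OF B H] by blast
  have pos: "card S > 0" if "subgroup S G" for S
    using finite_subset[OF subgroup.subset[OF that] fin] subgroup.one_closed[OF that] card_gt_0_iff by blast
  have "card D dvd order G"
    using card_subgroup_dvd[OF D subgroup_self subgroup.subset[OF D]] by (simp add: order_def)
  have dvd: "card D dvd lcm (card (A \<inter> B)) (card H)"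
  proof (rule multiplicity_le_imp_dvd)
    show "card D \<noteq> 0" using pos[OF D] by simp
    fix r :: nat assume r: "prime r"
    let ?n = "multiplicity r (card D)"
    have "r ^ ?n dvd lcm (card (A \<inter> B)) (card H)"
    proof (cases "r dvd card D")
      case False
      then show ?thesis by (simp add: not_dvd_imp_multiplicity_0)
    next
      case rD: True
      show ?thesis
      proof (cases "r \<in> s")
        case True
        have c: "card (rcosets H) * card H = order G" by (rule lagrange[OF H])
        have "\<not> r dvd card (rcosets H)"
          by (rule hall_subgroup_not_dvd_index[OF fin hall r True])
        then have "coprime (r ^ ?n) (card (rcosets H))" using r by (simp add: prime_imp_coprime)
        moreover have "r ^ ?n dvd card (rcosets H) * card H"
          using c \<open>card D dvd order G\<close> multiplicity_dvd dvd_trans by metis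
        ultimately have "r ^ ?n dvd card H" by (simp add: coprime_dvd_mult_right_iff)
        then show ?thesis by (rule dvd_lcmI2)
      next
        case False
        obtain m where "card D = r ^ ?n * m" using multiplicity_dvd by (rule dvdE)
        then obtain Q where Q: "subgroup Q (G\<lparr>carrier := D\<rparr>)" "card Q = r ^ ?n"
          using Sylow.sylow_thm[OF r subgroup_imp_group[OF D], of ?n m]
            finite_subset[OF subgroup.subset[OF D] fin] by (auto simp: order_def)
        have QG: "subgroup Q G" by (rule incl_subgroup[OF D Q(1)])
        have QD: "Q \<subseteq> D" using subgroup.subset[OF Q(1)] by simp
        have "r dvd order G" using rD \<open>card D dvd order G\<close> by (rule dvd_trans)
        then obtain t K where t: "t \<in> \<sigma>" "r \<in> t" and K: "hall_subgroup t K G" "Q \<subseteq> K"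
          using hall_subgroup_containing_prime_power_subgroup[OF fin part full r _ QG Q(2)] by blast
        have sK: "subgroup K G" using K(1) by (simp add: hall_subgroup_def)
        have "s \<inter> t = {}"
          using part s t False by (auto simp: partition_on_def disjoint_def)
        then have cop: "coprime (card H) (card K)"
          using hall_subgroups_coprime[OF hall K(1)] pos[OF H] pos[OF sK] by blast
        have "Q \<subseteq> C" if Cper: "sigma_permutable \<sigma> C G" and DC: "D \<subseteq> C <#> H" for C
        proof -
          have C: "subgroup C G" using Cper by (simp add: sigma_permutable_def)
          have "Q \<subseteq> (C <#> H) \<inter> (C <#> K)"
            using QD DC K(2) subset_set_mult_right[OF C sK] by blast
          also have "\<dots> = C"
            by (rule set_mult_Int_set_mult_coprime[OF fin C H sK perm[OF Cper s hall]
                  perm[OF Cper t(1) K(1)] cop])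
          finally show ?thesis .
        qed
        then have "Q \<subseteq> A \<inter> B" using Aper Bper unfolding D_def by blast
        then have "r ^ ?n dvd card (A \<inter> B)" using card_subgroup_dvd[OF QG X] Q(2) by simp
        then show ?thesis by (rule dvd_lcmI1)
      qed
    qed
    then show "?n \<le> multiplicity r (lcm (card (A \<inter> B)) (card H))"
      using r pos[OF X] pos[OF H] by (intro multiplicity_geI) (auto simp: lcm_eq_0_iff)
  qed
  have "(A \<inter> B) <#> H = D" by (rule set_mult_eq_if_card_dvd_lcm[OF fin X H D XD HD dvd])
  also have "D = H <#> (A \<inter> B)"
    using set_mult_eq_if_card_dvd_lcm[OF fin H X D HD XD] dvd by (simp add: lcm.commute)
  finally show ?thesis .
qed

section \<open>The lattice of subgroups\<close>

lemma (in group) subgroup_lattice_complete: "complete_lattice (subgroup_lattice G)"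
    unfolding subgroup_lattice_def by (rule subgroups_complete_lattice)

lemma (in group) subgroup_lattice_join:
  assumes "subgroup A G" "subgroup B G"
  shows "A \<squnion>\<^bsub>subgroup_lattice G\<^esub> B = generate G (A \<union> B)"
proof -
  let ?L = "subgroup_lattice G"
  interpret L: complete_lattice ?L by (rule subgroup_lattice_complete)
  have AB: "A \<in> carrier ?L" "B \<in> carrier ?L" using assms by (simp_all add: subgroup_lattice_def)
  show ?thesis
  proof (rule generateI)
    show "subgroup (A \<squnion>\<^bsub>?L\<^esub> B) G"
      using L.join_closed[OF AB] by (simp add: subgroup_lattice_def)
    show "A \<union> B \<subseteq> A \<squnion>\<^bsub>?L\<^esub> B"
      using L.join_left[OF AB] L.join_right[OF AB] by (simp add: subgroup_lattice_def)
    fix K assume "subgroup K G" "A \<union> B \<subseteq> K"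
    then show "A \<squnion>\<^bsub>?L\<^esub> B \<subseteq> K"
      using L.join_le[of A K B] AB by (simp add: subgroup_lattice_def)
  qed
qed

lemma (in group) subgroup_lattice_meet:
  assumes "subgroup A G" "subgroup B G"
  shows "A \<sqinter>\<^bsub>subgroup_lattice G\<^esub> B = A \<inter> B"
proof
  let ?L = "subgroup_lattice G"
  interpret L: complete_lattice ?L by (rule subgroup_lattice_complete)
  have AB: "A \<in> carrier ?L" "B \<in> carrier ?L" using assms by (simp_all add: subgroup_lattice_def)
  show "A \<sqinter>\<^bsub>?L\<^esub> B \<subseteq> A \<inter> B"
    using L.meet_left[OF AB] L.meet_right[OF AB] by (simp add: subgroup_lattice_def)
  show "A \<inter> B \<subseteq> A \<sqinter>\<^bsub>?L\<^esub> B"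
    using L.meet_le[of "A \<inter> B" A B] AB subgroups_Inter_pair[OF assms] by (simp add: subgroup_lattice_def)
qed

theorem theoremB:
  fixes G :: "('a, 'b) monoid_scheme" and \<sigma> :: "nat set set"
  assumes "group G" and "finite (carrier G)"
    and "partition_on {p::nat. prime p} \<sigma>"
    and "sigma_full \<sigma> G"
  shows "sublattice (sigma_permutable_subgroups \<sigma> G) (subgroup_lattice G) \<and>
    (\<forall>A \<in> sigma_permutable_subgroups \<sigma> G. \<forall>B \<in> sigma_permutable_subgroups \<sigma> G.
       generate G (A \<union> B) \<in> sigma_permutable_subgroups \<sigma> G \<and>
       A \<inter> B \<in> sigma_permutable_subgroups \<sigma> G)"
proof -
  interpret group G by fact
  let ?S = "sigma_permutable_subgroups \<sigma> G"
  have sub: "subgroup A G" if "A \<in> ?S" for A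
    using that by (simp add: sigma_permutable_subgroups_def sigma_permutable_def)
  have join: "generate G (A \<union> B) \<in> ?S" if "A \<in> ?S" "B \<in> ?S" for A B
  proof -
    have "A \<union> B \<subseteq> carrier G" using that by (auto dest: sub subgroup.mem_carrier)
    then have "subgroup (generate G (A \<union> B)) G" by (rule generate_is_subgroup)
    moreover have "generate G (A \<union> B) <#>\<^bsub>G\<^esub> H = H <#>\<^bsub>G\<^esub> generate G (A \<union> B)"
      if "s \<in> \<sigma>" "hall_subgroup s H G" for s H
    proof (rule generate_Un_set_mult_commute)
      show "subgroup H G" using that by (simp add: hall_subgroup_def)
      show "A <#>\<^bsub>G\<^esub> H = H <#>\<^bsub>G\<^esub> A" "B <#>\<^bsub>G\<^esub> H = H <#>\<^bsub>G\<^esub> B"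
        using \<open>A \<in> ?S\<close> \<open>B \<in> ?S\<close> that
        unfolding sigma_permutable_subgroups_def sigma_permutable_def by blast+
    qed (use \<open>A \<in> ?S\<close> \<open>B \<in> ?S\<close> sub in blast)+
    ultimately show ?thesis
      using assms(4) by (simp add: sigma_permutable_subgroups_def sigma_permutable_def)
  qed
  have meet: "A \<inter> B \<in> ?S" if "A \<in> ?S" "B \<in> ?S" for A B
  proof -
    have per: "sigma_permutable \<sigma> A G" "sigma_permutable \<sigma> B G"
      using that by (simp_all add: sigma_permutable_subgroups_def)
    have "subgroup (A \<inter> B) G" using sub that by (intro subgroups_Inter_pair)
    moreover have "(A \<inter> B) <#>\<^bsub>G\<^esub> H = H <#>\<^bsub>G\<^esub> (A \<inter> B)" if "s \<in> \<sigma>" "hall_subgroup s H G" for s H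
      using assms(2,3) per that by (rule Int_set_mult_hall_commute)
    ultimately show ?thesis
      using assms(4) by (simp add: sigma_permutable_subgroups_def sigma_permutable_def)
  qed
  have "{\<one>\<^bsub>G\<^esub>} \<in> ?S"
  proof -
    have "{\<one>\<^bsub>G\<^esub>} <#>\<^bsub>G\<^esub> H = H <#>\<^bsub>G\<^esub> {\<one>\<^bsub>G\<^esub>}" if "hall_subgroup s H G" for s H
    proof -
      have "H \<subseteq> carrier G" using that by (simp add: hall_subgroup_def subgroup.subset)
      then have "\<one>\<^bsub>G\<^esub> \<otimes>\<^bsub>G\<^esub> h = h \<otimes>\<^bsub>G\<^esub> \<one>\<^bsub>G\<^esub>" if "h \<in> H" for h
        using that by (simp add: subset_iff)
      then show ?thesis by (auto simp: mem_set_mult_iff)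
    qed
    then show ?thesis
      using assms(4) triv_subgroup by (auto simp: sigma_permutable_subgroups_def sigma_permutable_def)
  qed
  moreover have "?S \<subseteq> carrier (subgroup_lattice G)" using sub by (auto simp: subgroup_lattice_def)
  ultimately have "sublattice ?S (subgroup_lattice G)"
    unfolding sublattice_def using join meet sub
    by (auto simp: subgroup_lattice_join subgroup_lattice_meet)
  then show ?thesis using join meet by blast
qed

end
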